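(* Let $X$ be a Banach space with $\dim X\ge 2$ and let $1\le p<\infty$. Then $X$ is uniformly smooth if and only if $$\lim_{\alpha\to\frac12^-}\frac{\sqrt[p]{2^{p-1}C^I_{NJ}(\alpha,p,X)}-1}{1-2\alpha}=0.$$
   Context: $S_X$ denotes the unit sphere of $X$. For $x_1,x_2\in X$, isosceles orthogonality $x_1\perp_I x_2$ means $\|x_1+x_2\|=\|x_1-x_2\|$. For $1\le p<\infty$ and $0\le\alpha\le\frac12$, $$C^{I}_{NJ}(\alpha,p,X)=\sup\left\{\frac{\|\alpha x_1+(1-\alpha)x_2\|^{p}+\|(1-\alpha)x_1+\alpha x_2\|^{p}}{\|x_1+x_2\|^{p}}: x_1,x_2\in X,\ (x_1,x_2)\neq(0,0),\ x_1\perp_I x_2\right\}.$$ $X$ is uniformly smooth if $\lim_{t\to0^+}\rho_X(t)/t=0$, where $$\rho_X(t)=\sup\left\{\frac{\|x_1+tx_2\|+\|x_1-tx_2\|}{2}-1: x_1,x_2\in S_X\right\}.$$ *)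

theory Defs
  imports "HOL-Analysis.Analysis"
begin

definition isosceles_orthogonal :: "'a::real_normed_vector \<Rightarrow> 'a \<Rightarrow> bool"
    (infix "\<bottom>\<^sub>I" 50) where
  "x \<bottom>\<^sub>I y \<longleftrightarrow> norm (x + y) = norm (x - y)"

(* The real supremum is meaningful here: if x \<bottom>\<^sub>I y and (x, y) \<noteq> (0, 0), then x + y \<noteq> 0, and
   for 0 \<le> \<alpha> \<le> 1/2 each quotient is at most 2 (1 - \<alpha>)^p.  The set is nonempty in a nonzero
   space, since x \<bottom>\<^sub>I 0. *)
definition C_NJ_I :: "real \<Rightarrow> real \<Rightarrow> 'a::real_normed_vector itself \<Rightarrow> real" where
  "C_NJ_I \<alpha> p X = Sup {(norm (\<alpha> *\<^sub>R x\<^sub>1 + (1 - \<alpha>) *\<^sub>R x\<^sub>2) powr p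
                        + norm ((1 - \<alpha>) *\<^sub>R x\<^sub>1 + \<alpha> *\<^sub>R x\<^sub>2) powr p) / norm (x\<^sub>1 + x\<^sub>2) powr p
     | x\<^sub>1 x\<^sub>2 :: 'a. (x\<^sub>1, x\<^sub>2) \<noteq> (0, 0) \<and> x\<^sub>1 \<bottom>\<^sub>I x\<^sub>2}"

(* The set is bounded above by \<bar>t\<bar>, and nonempty in a nonzero space. *)
definition smoothness_modulus :: "'a::real_normed_vector itself \<Rightarrow> real \<Rightarrow> real" where
  "smoothness_modulus X t = Sup {(norm (x\<^sub>1 + t *\<^sub>R x\<^sub>2) + norm (x\<^sub>1 - t *\<^sub>R x\<^sub>2)) / 2 - 1
     | x\<^sub>1 x\<^sub>2 :: 'a. x\<^sub>1 \<in> sphere 0 1 \<and> x\<^sub>2 \<in> sphere 0 1}"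

definition uniformly_smooth :: "'a::real_normed_vector itself \<Rightarrow> bool" where
  "uniformly_smooth X \<longleftrightarrow> ((\<lambda>t. smoothness_modulus X t / t) \<longlongrightarrow> 0) (at_right 0)"

(* The library's dim is 0 on infinite-dimensional spaces, so dimension at least 2 is expressed
   by a linearly independent set of two vectors. *)
definition dim_at_least_2 :: "'a::real_vector itself \<Rightarrow> bool" where
  "dim_at_least_2 X \<longleftrightarrow> (\<exists>B :: 'a set. independent B \<and> card B = 2)"

end

theory Submission
  imports Defs
begin

text \<open>
  The substitution \<open>u = x\<^sub>1 + x\<^sub>2\<close>, \<open>v = x\<^sub>1 - x\<^sub>2\<close> turns isosceles orthogonality
  into \<open>\<parallel>u\<parallel> = \<parallel>v\<parallel>\<close>; by homogeneity, with \<open>s = 1 - 2\<alpha>\<close>, the quantity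
  \<open>Q(s) = 2\<^sup>p\<^sup>-\<^sup>1 C(\<alpha>, p)\<close> is the supremum of \<open>(\<parallel>u + s v\<parallel>\<^sup>p + \<parallel>u - s v\<parallel>\<^sup>p) / 2\<close>
  over unit vectors. Convexity of the \<open>p\<close>-th power gives \<open>1 + \<rho>(s) \<le> Q(s)\<^sup>1\<^sup>/\<^sup>p\<close>. Conversely,
  both norms lie within \<open>s\<close> of 1, so linearising the \<open>p\<close>-th power at 1 gives
  \<open>Q(s)\<^sup>1\<^sup>/\<^sup>p \<le> Q(s) \<le> 1 + p \<rho>(s) + o(s)\<close>.
\<close>

section \<open>Elementary estimates for norms and real powers\<close>

lemma norm_add_sub_ge:
  fixes u v :: "'a::real_normed_vector"
  shows "2 * norm u \<le> norm (u + v) + norm (u - v)"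
proof -
  have "norm ((u + v) + (u - v)) \<le> norm (u + v) + norm (u - v)"
    by (rule norm_triangle_ineq)
  moreover have "(u + v) + (u - v) = 2 *\<^sub>R u"
    by (simp add: scaleR_2)
  ultimately show ?thesis
    by simp
qed

lemma abs_norm_add_scaleR_diff_le:
  fixes u v :: "'a::real_normed_vector"
  assumes "norm u = 1" "norm v = 1"
  shows "\<bar>norm (u + s *\<^sub>R v) - 1\<bar> \<le> \<bar>s\<bar>" "\<bar>norm (u - s *\<^sub>R v) - 1\<bar> \<le> \<bar>s\<bar>"
  using norm_triangle_ineq3[of "u + s *\<^sub>R v" u] norm_triangle_ineq3[of "u - s *\<^sub>R v" u] assms
  by simp_all

text \<open>Midpoint convexity of the power. \<open>powr_convex\<close> is applied at positive
  points only; if one argument is 0, the claim reduces to 2 \<le> \<open>2 powr p\<close>, which is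
  what \<open>half\<close> expresses.\<close>

lemma powr_mean_le:
  fixes a b p :: real
  assumes "1 \<le> p" "0 \<le> a" "0 \<le> b"
  shows "((a + b) / 2) powr p \<le> (a powr p + b powr p) / 2"
proof -
  have half: "(c / 2) powr p \<le> c powr p / 2" for c :: real
  proof -
    have "2 powr 1 \<le> (2 :: real) powr p"
      by (rule powr_mono) (use assms(1) in auto)
    then show ?thesis
      unfolding powr_divide by (intro divide_left_mono) auto
  qed
  consider "a = 0" | "b = 0" | "0 < a" "0 < b"
    using assms(2,3) by linarith
  then show ?thesis
  proof cases
    case 3
    then show ?thesis
      using convex_onD[OF powr_convex[OF assms(1)], of "1/2" a b]
      by (simp add: field_simps)
  qed (use half[of a] half[of b] in simp_all)
qed

text \<open>First-order expansion at 1, where the derivative is p. The radius d depends on p and e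
  alone, which later makes the estimate uniform over all pairs of unit vectors.\<close>

lemma powr_near_one_le:
  fixes p e :: real
  assumes "0 < e"
  obtains d where "0 < d" "\<And>x. \<bar>x - 1\<bar> < d \<Longrightarrow> x powr p \<le> 1 + p * (x - 1) + e * \<bar>x - 1\<bar>"
proof -
  have "((\<lambda>x::real. x powr p) has_real_derivative p) (at 1)"
    by (auto intro!: derivative_eq_intros)
  then obtain d where d: "0 < d"
      "\<And>x. \<bar>x - 1\<bar> < d \<Longrightarrow> \<bar>x powr p - 1 - p * (x - 1)\<bar> \<le> e * \<bar>x - 1\<bar>"
    using assms unfolding has_field_derivative_def has_derivative_at_alt by force
  have "x powr p \<le> 1 + p * (x - 1) + e * \<bar>x - 1\<bar>" if "\<bar>x - 1\<bar> < d" for x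
    using d(2)[OF that] by linarith
  with d(1) show thesis
    by (rule that)
qed

text \<open>A unit vector makes the index sets of both suprema nonempty, as
  \<open>cSup_least\<close> requires.\<close>

lemma dim_at_least_2_unit_vector:
  assumes "dim_at_least_2 TYPE('a::real_normed_vector)"
  obtains u :: "'a::real_normed_vector" where "norm u = 1"
proof -
  obtain B :: "'a set" where "independent B" "card B = 2"
    using assms unfolding dim_at_least_2_def by blast
  then obtain x where "x \<in> B" "x \<noteq> 0"
    by (metis card.empty dependent_zero equals0I zero_neq_numeral)
  then show thesis
    using that[of "x /\<^sub>R norm x"] by simp
qed

section \<open>Bounds for the modulus of smoothness\<close>

lemma smoothness_modulus_upper:
  fixes u v :: "'a::real_normed_vector"
  assumes "norm u = 1" "norm v = 1"
  shows "(norm (u + s *\<^sub>R v) + norm (u - s *\<^sub>R v)) / 2 - 1 \<le> smoothness_modulus TYPE('a) s"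
  unfolding smoothness_modulus_def
proof (rule cSup_upper)
  show "bdd_above {(norm (x\<^sub>1 + s *\<^sub>R x\<^sub>2) + norm (x\<^sub>1 - s *\<^sub>R x\<^sub>2)) / 2 - 1
     | x\<^sub>1 x\<^sub>2 :: 'a. x\<^sub>1 \<in> sphere 0 1 \<and> x\<^sub>2 \<in> sphere 0 1}"
    unfolding bdd_above_def
  proof (intro exI[of _ "\<bar>s\<bar>"] ballI, safe)
    fix x y :: 'a
    assume "x \<in> sphere 0 1" "y \<in> sphere 0 1"
    then have "norm x = 1" "norm y = 1"
      by simp_all
    from abs_norm_add_scaleR_diff_le[OF this, of s]
    show "(norm (x + s *\<^sub>R y) + norm (x - s *\<^sub>R y)) / 2 - 1 \<le> \<bar>s\<bar>"
      by argo
  qed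
qed (use assms in auto)

lemma smoothness_modulus_nonneg:
  assumes "dim_at_least_2 TYPE('a::real_normed_vector)"
  shows "0 \<le> smoothness_modulus TYPE('a) s"
proof -
  obtain u :: 'a where u: "norm u = 1"
    using dim_at_least_2_unit_vector[OF assms] .
  show ?thesis
    using smoothness_modulus_upper[OF u u, of s] norm_add_sub_ge[of u "s *\<^sub>R u"] u by argo
qed

lemma smoothness_modulus_least:
  assumes "dim_at_least_2 TYPE('a::real_normed_vector)"
    and "\<And>u v :: 'a. norm u = 1 \<Longrightarrow> norm v = 1 \<Longrightarrow>
      (norm (u + s *\<^sub>R v) + norm (u - s *\<^sub>R v)) / 2 - 1 \<le> K"
  shows "smoothness_modulus TYPE('a) s \<le> K"
proof -
  obtain u :: 'a where u: "norm u = 1"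
    using dim_at_least_2_unit_vector[OF assms(1)] .
  show ?thesis
    unfolding smoothness_modulus_def
    by (rule cSup_least) (use u assms(2) in auto)
qed

section \<open>The constant as a supremum over unit vectors\<close>

text \<open>The quotient is homogeneous of degree 0, so the common norm n of x + y and x - y can be
  divided out. What remains are two unit vectors with no relation between them; the denominator
  \<open>2 powr p\<close> comes from the factor n / 2 in x and y.\<close>

lemma C_NJ_I_eq_Sup_unit:
  fixes \<alpha> p :: real
  defines "s \<equiv> 1 - 2 * \<alpha>"
  shows "C_NJ_I \<alpha> p TYPE('a::real_normed_vector) =
    Sup {(norm (u + s *\<^sub>R v) powr p + norm (u - s *\<^sub>R v) powr p) / 2 powr p
      | u v :: 'a. norm u = 1 \<and> norm v = 1}" (is "_ = Sup ?R")
proof -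
  define quot :: "'a \<Rightarrow> 'a \<Rightarrow> real" where
    "quot x y = (norm (\<alpha> *\<^sub>R x + (1 - \<alpha>) *\<^sub>R y) powr p
      + norm ((1 - \<alpha>) *\<^sub>R x + \<alpha> *\<^sub>R y) powr p) / norm (x + y) powr p" for x y
  \<comment> \<open>One computation serves both inclusions: with n = \<open>norm (x + y)\<close> for
    a given orthogonal pair, with n = 1 for given unit vectors.\<close>
  have quot: "quot x y = (norm (u + s *\<^sub>R v) powr p + norm (u - s *\<^sub>R v) powr p) / 2 powr p"
    if n: "0 < n" and u: "norm u = 1" and xy: "x + y = n *\<^sub>R u" "x - y = n *\<^sub>R v" for n x y u v
  proof -
    have x: "x = (n / 2) *\<^sub>R (u + v)"
    proof -
      have "2 *\<^sub>R x = n *\<^sub>R (u + v)"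
        using arg_cong2[of _ _ _ _ "(+)", OF xy] by (simp add: scaleR_2 scaleR_add_right)
      then have "(1 / 2) *\<^sub>R (2 *\<^sub>R x) = (1 / 2) *\<^sub>R (n *\<^sub>R (u + v))"
        by (rule arg_cong)
      then show ?thesis
        by simp
    qed
    have y: "y = (n / 2) *\<^sub>R (u - v)"
    proof -
      have "2 *\<^sub>R y = n *\<^sub>R (u - v)"
        using arg_cong2[of _ _ _ _ "(-)", OF xy] by (simp add: scaleR_2 scaleR_diff_right)
      then have "(1 / 2) *\<^sub>R (2 *\<^sub>R y) = (1 / 2) *\<^sub>R (n *\<^sub>R (u - v))"
        by (rule arg_cong)
      then show ?thesis
        by simp
    qed
    have combine: "a *\<^sub>R (u + v) + b *\<^sub>R (u - v) = c *\<^sub>R (u + t *\<^sub>R v)"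
      if "a + b = c" "a - b = c * t" for a b c t
    proof -
      have "c *\<^sub>R (u + t *\<^sub>R v) = (a + b) *\<^sub>R u + (a - b) *\<^sub>R v"
        unfolding that by (simp add: scaleR_add_right)
      then show ?thesis
        by (simp add: algebra_simps)
    qed
    \<comment> \<open>The coefficients \<alpha> n / 2 and (1 - \<alpha>) n / 2 have sum n / 2, and
      their difference is s n / 2 up to a sign that depends on their order; hence - s in the first
      vector.\<close>
    have "\<alpha> *\<^sub>R x + (1 - \<alpha>) *\<^sub>R y = (n / 2) *\<^sub>R (u + (- s) *\<^sub>R v)"
      "(1 - \<alpha>) *\<^sub>R x + \<alpha> *\<^sub>R y = (n / 2) *\<^sub>R (u + s *\<^sub>R v)"
      unfolding x y s_def scaleR_scaleR by (rule combine; simp add: field_simps)+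
    then have "quot x y =
        ((n / 2 * norm (u - s *\<^sub>R v)) powr p + (n / 2 * norm (u + s *\<^sub>R v)) powr p) / n powr p"
      unfolding quot_def xy(1) using n u by simp
    also have "\<dots> = (norm (u + s *\<^sub>R v) powr p + norm (u - s *\<^sub>R v) powr p) / 2 powr p"
      using n by (simp add: powr_mult powr_divide field_simps)
    finally show ?thesis .
  qed
  have "{quot x y | x y. (x, y) \<noteq> (0, 0) \<and> x \<bottom>\<^sub>I y} = ?R"
  proof (intro equalityI subsetI)
    fix r
    assume "r \<in> {quot x y | x y. (x, y) \<noteq> (0, 0) \<and> x \<bottom>\<^sub>I y}"
    then obtain x y where r: "r = quot x y" and nz: "(x, y) \<noteq> (0, 0)"
      and orth: "norm (x + y) = norm (x - y)"
      unfolding isosceles_orthogonal_def by blast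
    \<comment> \<open>If x + y = 0, orthogonality forces x - y = 0 as well, so both vectors
      vanish.\<close>
    have "x + y \<noteq> 0"
    proof
      assume 0: "x + y = 0"
      with orth have "x = y"
        by simp
      with 0 have "2 *\<^sub>R x = 0"
        by (simp add: scaleR_2)
      with \<open>x = y\<close> nz show False
        by simp
    qed
    then have n: "0 < norm (x + y)"
      by simp
    let ?u = "(x + y) /\<^sub>R norm (x + y)" and ?v = "(x - y) /\<^sub>R norm (x + y)"
    have "norm ?u = 1" "norm ?v = 1"
      using n by (simp_all flip: orth)
    moreover have "r = (norm (?u + s *\<^sub>R ?v) powr p + norm (?u - s *\<^sub>R ?v) powr p) / 2 powr p"
      unfolding r by (rule quot[OF n]) (use n in auto)
    ultimately show "r \<in> ?R"
      by blast
  next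
    fix r
    assume "r \<in> ?R"
    then obtain u v :: 'a where u: "norm u = 1" and v: "norm v = 1"
      and r: "r = (norm (u + s *\<^sub>R v) powr p + norm (u - s *\<^sub>R v) powr p) / 2 powr p"
      by blast
    define x y where "x = (1 / 2) *\<^sub>R (u + v)" and "y = (1 / 2) *\<^sub>R (u - v)"
    have sum: "x + y = 1 *\<^sub>R u" and diff: "x - y = 1 *\<^sub>R v"
      unfolding x_def y_def by (simp_all add: algebra_simps flip: scaleR_add_left)
    have "r = quot x y"
      unfolding r by (rule quot[OF _ u sum diff, symmetric]) simp
    moreover have "(x, y) \<noteq> (0, 0)"
      using sum u by auto
    moreover have "x \<bottom>\<^sub>I y"
      unfolding isosceles_orthogonal_def sum diff using u v by simp
    ultimately show "r \<in> {quot x y | x y. (x, y) \<noteq> (0, 0) \<and> x \<bottom>\<^sub>I y}"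
      by blast
  qed
  then show ?thesis
    unfolding C_NJ_I_def quot_def by simp
qed

text \<open>Both norms are at most 1 + |s|, so the supremum dominates its terms. The factor
  \<open>2 powr (p - 1)\<close> turns the denominator \<open>2 powr p\<close> into 2, giving an
  average of p-th powers.\<close>

lemma C_NJ_I_upper:
  fixes u v :: "'a::real_normed_vector"
  assumes "0 \<le> p" "norm u = 1" "norm v = 1"
  shows "(norm (u + (1 - 2 * \<alpha>) *\<^sub>R v) powr p + norm (u - (1 - 2 * \<alpha>) *\<^sub>R v) powr p) / 2
    \<le> 2 powr (p - 1) * C_NJ_I \<alpha> p TYPE('a)"
proof -
  define s where "s = 1 - 2 * \<alpha>"
  let ?R = "{(norm (u + s *\<^sub>R v) powr p + norm (u - s *\<^sub>R v) powr p) / 2 powr p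
      | u v :: 'a. norm u = 1 \<and> norm v = 1}"
  have "bdd_above ?R"
    unfolding bdd_above_def
  proof (intro exI[of _ "2 * (1 + \<bar>s\<bar>) powr p / 2 powr p"] ballI, safe)
    fix x y :: 'a
    assume "norm x = 1" "norm y = 1"
    note bounds = abs_norm_add_scaleR_diff_le[OF this, of s]
    have "norm (x + s *\<^sub>R y) powr p \<le> (1 + \<bar>s\<bar>) powr p"
      "norm (x - s *\<^sub>R y) powr p \<le> (1 + \<bar>s\<bar>) powr p"
      using bounds assms(1) by (auto intro!: powr_mono2)
    then show "(norm (x + s *\<^sub>R y) powr p + norm (x - s *\<^sub>R y) powr p) / 2 powr p
        \<le> 2 * (1 + \<bar>s\<bar>) powr p / 2 powr p"
      by (intro divide_right_mono) auto
  qed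
  then have "(norm (u + s *\<^sub>R v) powr p + norm (u - s *\<^sub>R v) powr p) / 2 powr p
      \<le> C_NJ_I \<alpha> p TYPE('a)"
    unfolding C_NJ_I_eq_Sup_unit s_def[symmetric]
    by (intro cSup_upper) (use assms in auto)
  then show ?thesis
    unfolding s_def by (simp add: powr_diff field_simps)
qed

lemma C_NJ_I_least:
  assumes "dim_at_least_2 TYPE('a::real_normed_vector)"
    and "\<And>u v :: 'a. norm u = 1 \<Longrightarrow> norm v = 1 \<Longrightarrow>
      (norm (u + (1 - 2 * \<alpha>) *\<^sub>R v) powr p + norm (u - (1 - 2 * \<alpha>) *\<^sub>R v) powr p) / 2 \<le> K"
  shows "2 powr (p - 1) * C_NJ_I \<alpha> p TYPE('a) \<le> K"
proof -
  obtain u :: 'a where u: "norm u = 1"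
    using dim_at_least_2_unit_vector[OF assms(1)] .
  have "C_NJ_I \<alpha> p TYPE('a) \<le> 2 * K / 2 powr p"
    unfolding C_NJ_I_eq_Sup_unit
  proof (rule cSup_least)
    fix r
    assume "r \<in> {(norm (u + (1 - 2 * \<alpha>) *\<^sub>R v) powr p
        + norm (u - (1 - 2 * \<alpha>) *\<^sub>R v) powr p) / 2 powr p
      | u v :: 'a. norm u = 1 \<and> norm v = 1}"
    then obtain x y :: 'a where xy: "norm x = 1" "norm y = 1"
      and r: "r = (norm (x + (1 - 2 * \<alpha>) *\<^sub>R y) powr p
        + norm (x - (1 - 2 * \<alpha>) *\<^sub>R y) powr p) / 2 powr p"
      by blast
    show "r \<le> 2 * K / 2 powr p"
      unfolding r using assms(2)[OF xy] by (intro divide_right_mono) auto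
  qed (use u in blast)
  then show ?thesis
    by (simp add: powr_diff field_simps)
qed

section \<open>Comparison of the constant with the modulus of smoothness\<close>

lemma smoothness_modulus_le_C_NJ_I:
  assumes "dim_at_least_2 TYPE('a::real_normed_vector)" "1 \<le> p"
  shows "1 + smoothness_modulus TYPE('a) (1 - 2 * \<alpha>)
    \<le> (2 powr (p - 1) * C_NJ_I \<alpha> p TYPE('a)) powr (1 / p)"
proof -
  have "smoothness_modulus TYPE('a) (1 - 2 * \<alpha>)
      \<le> (2 powr (p - 1) * C_NJ_I \<alpha> p TYPE('a)) powr (1 / p) - 1"
  proof (rule smoothness_modulus_least[OF assms(1)])
    fix u v :: 'a
    assume uv: "norm u = 1" "norm v = 1"
    define a b where "a = norm (u + (1 - 2 * \<alpha>) *\<^sub>R v)" and "b = norm (u - (1 - 2 * \<alpha>) *\<^sub>R v)"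
    have nonneg: "0 \<le> a" "0 \<le> b"
      unfolding a_def b_def by simp_all
    have "((a + b) / 2) powr p \<le> (a powr p + b powr p) / 2"
      by (rule powr_mean_le[OF assms(2) nonneg])
    also have "\<dots> \<le> 2 powr (p - 1) * C_NJ_I \<alpha> p TYPE('a)"
      unfolding a_def b_def by (rule C_NJ_I_upper) (use uv assms(2) in auto)
    \<comment> \<open>The p-th root is monotone, and it undoes the power because the mean is
      nonnegative.\<close>
    finally have "(((a + b) / 2) powr p) powr (1 / p)
        \<le> (2 powr (p - 1) * C_NJ_I \<alpha> p TYPE('a)) powr (1 / p)"
      by (intro powr_mono2) (use assms(2) in auto)
    moreover have "(((a + b) / 2) powr p) powr (1 / p) = (a + b) / 2"
      using assms(2) nonneg by (simp add: powr_powr)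
    ultimately show "(norm (u + (1 - 2 * \<alpha>) *\<^sub>R v) + norm (u - (1 - 2 * \<alpha>) *\<^sub>R v)) / 2 - 1
        \<le> (2 powr (p - 1) * C_NJ_I \<alpha> p TYPE('a)) powr (1 / p) - 1"
      unfolding a_def b_def by simp
  qed
  then show ?thesis
    by simp
qed

lemma C_NJ_I_root_le_smoothness_modulus:
  fixes p e :: real
  assumes "dim_at_least_2 TYPE('a::real_normed_vector)" "1 \<le> p" "0 < e"
  obtains d where "0 < d" "\<And>\<alpha>. \<bar>1 - 2 * \<alpha>\<bar> < d \<Longrightarrow>
    (2 powr (p - 1) * C_NJ_I \<alpha> p TYPE('a)) powr (1 / p)
      \<le> 1 + p * smoothness_modulus TYPE('a) (1 - 2 * \<alpha>) + e * \<bar>1 - 2 * \<alpha>\<bar>"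
proof -
  obtain d where d: "0 < d"
    "\<And>x. \<bar>x - 1\<bar> < d \<Longrightarrow> x powr p \<le> 1 + p * (x - 1) + e * \<bar>x - 1\<bar>"
    using powr_near_one_le[OF assms(3)] by blast
  show thesis
  proof (rule that[OF d(1)])
    fix \<alpha> :: real
    define s where "s = 1 - 2 * \<alpha>"
    let ?Q = "2 powr (p - 1) * C_NJ_I \<alpha> p TYPE('a)"
    let ?\<rho> = "smoothness_modulus TYPE('a) s"
    assume "\<bar>1 - 2 * \<alpha>\<bar> < d"
    then have s: "\<bar>s\<bar> < d"
      by (simp add: s_def)
    have Q: "?Q \<le> 1 + p * ?\<rho> + e * \<bar>s\<bar>"
    proof (rule C_NJ_I_least[OF assms(1)], unfold s_def[symmetric])
      fix u v :: 'a
      assume uv: "norm u = 1" "norm v = 1"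
      define a b where "a = norm (u + s *\<^sub>R v)" and "b = norm (u - s *\<^sub>R v)"
      have ab: "\<bar>a - 1\<bar> \<le> \<bar>s\<bar>" "\<bar>b - 1\<bar> \<le> \<bar>s\<bar>"
        unfolding a_def b_def by (rule abs_norm_add_scaleR_diff_le[OF uv])+
      \<comment> \<open>Only the error term is replaced by its worst case. The linear term keeps its
        sign, so that a and b together yield p ((a + b) / 2 - 1), which the modulus
        controls.\<close>
      have "x powr p \<le> 1 + p * (x - 1) + e * \<bar>s\<bar>" if "\<bar>x - 1\<bar> \<le> \<bar>s\<bar>" for x
      proof -
        have "x powr p \<le> 1 + p * (x - 1) + e * \<bar>x - 1\<bar>"
          using that s by (intro d(2)) linarith
        also have "e * \<bar>x - 1\<bar> \<le> e * \<bar>s\<bar>"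
          using that assms(3) by (intro mult_left_mono) auto
        finally show ?thesis
          by simp
      qed
      from this[OF ab(1)] this[OF ab(2)]
      have "(a powr p + b powr p) / 2 \<le> 1 + p * ((a + b) / 2 - 1) + e * \<bar>s\<bar>"
        by (simp add: field_simps)
      also have "p * ((a + b) / 2 - 1) \<le> p * ?\<rho>"
        unfolding a_def b_def
        using smoothness_modulus_upper[OF uv] assms(2) by (intro mult_left_mono) auto
      finally show "(norm (u + s *\<^sub>R v) powr p + norm (u - s *\<^sub>R v) powr p) / 2
          \<le> 1 + p * ?\<rho> + e * \<bar>s\<bar>"
        unfolding a_def b_def by simp
    qed
    have "?Q powr (1 / p) \<le> 1 + p * ?\<rho> + e * \<bar>s\<bar>"
    \<comment> \<open>Above 1 the root does not exceed its argument. Below 1 the root is at most 1,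
      hence at most the right-hand side, whose other terms are nonnegative.\<close>
    proof (cases "1 \<le> ?Q")
      case True
      then have "?Q powr (1 / p) \<le> ?Q powr 1"
        by (intro powr_mono) (use assms(2) in auto)
      with True Q show ?thesis
        by simp
    next
      case False
      have "0 \<le> ?Q"
      proof -
        obtain u :: 'a where u: "norm u = 1"
          using dim_at_least_2_unit_vector[OF assms(1)] .
        show ?thesis
          by (rule order_trans[OF _ C_NJ_I_upper[OF _ u u]]) (use assms(2) in auto)
      qed
      with False have "?Q powr (1 / p) \<le> 1 powr (1 / p)"
        by (intro powr_mono2) (use assms(2) in auto)
      moreover have "0 \<le> p * ?\<rho>" "0 \<le> e * \<bar>s\<bar>"
        using smoothness_modulus_nonneg[OF assms(1)] assms(2,3) by simp_all
      ultimately show ?thesis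
        by simp
    qed
    then show "?Q powr (1 / p)
        \<le> 1 + p * smoothness_modulus TYPE('a) (1 - 2 * \<alpha>) + e * \<bar>1 - 2 * \<alpha>\<bar>"
      by (simp add: s_def)
  qed
qed

section \<open>Transfer of the limit between \<alpha> and s\<close>

lemma filterlim_one_minus_double:
  "filterlim (\<lambda>\<alpha>::real. 1 - 2 * \<alpha>) (at_right 0) (at_left (1 / 2))"
  unfolding filterlim_at
proof (rule conjI[rotated])
  show "((\<lambda>\<alpha>::real. 1 - 2 * \<alpha>) \<longlongrightarrow> 0) (at_left (1 / 2))"
    by (auto intro!: tendsto_eq_intros)
  show "\<forall>\<^sub>F \<alpha> in at_left (1 / 2). 1 - 2 * \<alpha> \<in> {0::real<..} \<and> 1 - 2 * \<alpha> \<noteq> 0"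
    by (rule eventually_at_leftI[of 0]) auto
qed

lemma filterlim_one_minus_halved:
  "filterlim (\<lambda>s::real. (1 - s) / 2) (at_left (1 / 2)) (at_right 0)"
  unfolding filterlim_at
  by (auto intro!: tendsto_eq_intros eventually_at_rightI[of 0 1])

theorem theorem6:
  fixes p :: real
  assumes "dim_at_least_2 TYPE('a::banach)"
    and "1 \<le> p"
  shows "uniformly_smooth TYPE('a) \<longleftrightarrow>
    ((\<lambda>\<alpha>. ((2 powr (p - 1) * C_NJ_I \<alpha> p TYPE('a)) powr (1 / p) - 1) / (1 - 2 * \<alpha>)) \<longlongrightarrow> 0)
      (at_left (1 / 2))"
proof -
  define M where "M \<alpha> = (2 powr (p - 1) * C_NJ_I \<alpha> p TYPE('a)) powr (1 / p)" for \<alpha>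
  let ?\<rho> = "smoothness_modulus TYPE('a)"
  have nonneg: "0 \<le> ?\<rho> s" for s
    by (rule smoothness_modulus_nonneg[OF assms(1)])
  \<comment> \<open>Used in both directions: for the sign of the quotient in the first, as the
    majorant of the modulus in the second.\<close>
  have lower: "?\<rho> (1 - 2 * \<alpha>) \<le> M \<alpha> - 1" for \<alpha>
    using smoothness_modulus_le_C_NJ_I[OF assms, of \<alpha>] unfolding M_def by simp
  have "((\<lambda>\<alpha>. (M \<alpha> - 1) / (1 - 2 * \<alpha>)) \<longlongrightarrow> 0) (at_left (1 / 2))"
    if "((\<lambda>s. ?\<rho> s / s) \<longlongrightarrow> 0) (at_right 0)"
  proof (rule tendstoI)
    fix e :: real
    assume e: "0 < e"
    \<comment> \<open>Half of e absorbs the linearisation error. The bound e / (2 p) on \<rho>(s) /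
      s keeps p \<rho>(s) below the other half, times s.\<close>
    obtain d where d: "0 < d"
      "\<And>\<alpha>. \<bar>1 - 2 * \<alpha>\<bar> < d \<Longrightarrow> M \<alpha> \<le> 1 + p * ?\<rho> (1 - 2 * \<alpha>) + e / 2 * \<bar>1 - 2 * \<alpha>\<bar>"
      using C_NJ_I_root_le_smoothness_modulus[OF assms, of "e / 2"] e
      unfolding M_def by (metis half_gt_zero)
    have "\<forall>\<^sub>F s in at_right 0. ?\<rho> s / s < e / (2 * p)"
      using order_tendstoD(2)[OF that, of "e / (2 * p)"] e assms(2) by simp
    moreover have "\<forall>\<^sub>F s in at_right 0. s \<in> {0<..<d}"
      by (rule eventually_at_right_real[OF d(1)])
    ultimately have "\<forall>\<^sub>F s in at_right 0. s \<in> {0<..<d} \<and> ?\<rho> s / s < e / (2 * p)"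
      by eventually_elim simp
    then have "\<forall>\<^sub>F \<alpha> in at_left (1 / 2). 1 - 2 * \<alpha> \<in> {0<..<d} \<and>
        ?\<rho> (1 - 2 * \<alpha>) / (1 - 2 * \<alpha>) < e / (2 * p)"
      by (rule eventually_compose_filterlim[OF _ filterlim_one_minus_double])
    then show "\<forall>\<^sub>F \<alpha> in at_left (1 / 2). dist ((M \<alpha> - 1) / (1 - 2 * \<alpha>)) 0 < e"
    proof eventually_elim
      case (elim \<alpha>)
      define s where "s = 1 - 2 * \<alpha>"
      have s: "0 < s" "s < d" "?\<rho> s / s < e / (2 * p)"
        using elim by (auto simp: s_def)
      have "M \<alpha> - 1 \<le> p * ?\<rho> s + e / 2 * s"
        using d(2)[of \<alpha>] s by (simp add: s_def)
      moreover have "p * ?\<rho> s < e / 2 * s"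
        using s(1,3) assms(2) by (simp add: field_simps)
      ultimately have "M \<alpha> - 1 < e * s"
        by (simp add: field_simps)
      moreover have "0 \<le> M \<alpha> - 1"
        using lower[of \<alpha>] nonneg[of "1 - 2 * \<alpha>"] by linarith
      ultimately show ?case
        using s(1) unfolding s_def[symmetric] by (simp add: dist_real_def field_simps)
    qed
  qed
  moreover have "((\<lambda>s. ?\<rho> s / s) \<longlongrightarrow> 0) (at_right 0)"
    if "((\<lambda>\<alpha>. (M \<alpha> - 1) / (1 - 2 * \<alpha>)) \<longlongrightarrow> 0) (at_left (1 / 2))"
  \<comment> \<open>With \<alpha> = (1 - s) / 2, so that 1 - 2 \<alpha> = s, the quotient \<rho>(s)
    / s is squeezed between 0 and the given quotient.\<close>
  proof (rule tendsto_sandwich[where f = "\<lambda>_. 0"])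
    have double_halved: "1 - 2 * ((1 - s) / 2) = s" for s :: real
      by (simp add: field_simps)
    show "((\<lambda>s. (M ((1 - s) / 2) - 1) / s) \<longlongrightarrow> 0) (at_right 0)"
      using filterlim_compose[OF that filterlim_one_minus_halved] by (simp only: double_halved)
    have pos: "\<forall>\<^sub>F s :: real in at_right 0. 0 < s"
      by (rule eventually_at_right_less)
    then show "\<forall>\<^sub>F s in at_right 0. 0 \<le> ?\<rho> s / s"
      by eventually_elim (simp add: nonneg)
    show "\<forall>\<^sub>F s in at_right 0. ?\<rho> s / s \<le> (M ((1 - s) / 2) - 1) / s"
      using pos
    proof eventually_elim
      case (elim s)
      then show ?case
        using lower[of "(1 - s) / 2", unfolded double_halved] by (intro divide_right_mono) auto
    qed
  qed simp
  ultimately show ?thesis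
    unfolding uniformly_smooth_def M_def by blast
qed

end
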